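(* For all $m,n\in\mathbb{Q}_{>0}$ with $m\neq n$ and every integer $N\ge3$, writing $N'=N-1$, $$\sum_{\substack{j+k=N\\ j\ge1,\,k\ge2}}\zeta^\mu(j,k;n,m+n)=\zeta^\mu(1,N';m,n)-\zeta^\mu(1,N';m,m+n)-\mu\frac{\mathcal{D}^\mu(1;m;n)}{(n-m)^{N-1}}+\mathcal{D}^\mu(N',1;n,m;n,m+n)+\mu\sum_{\substack{i+k=N-2\\ i\ge1,\,k\ge0}}\frac{\zeta^\mu(k+2;n)}{(n-m)^{i}}.$$ Moreover, for every $n\in\mathbb{Q}_{>0}$ and $N\ge3$, $$\sum_{\substack{j+k=N\\ j\ge1,\,k\ge2}}\zeta^\mu(j,k;n,2n)=\zeta^\mu(1,N';n,n)-\zeta^\mu(1,N';n,2n)-\mu\,\zeta^\mu(N;n)+\mathcal{D}^\mu(N',1;n,n;n,2n).$$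
   Context: Fix $\mu\in\mathbb{C}$ with $\mathrm{Re}(\mu)>0$. For $k_1,\dots,k_r\in\mathbb{N}$ with $k_r\ge2$ and $m_1,\dots,m_r\in\mathbb{Q}_{>0}$, $\zeta^\mu(k_1,\dots,k_r;m_1,\dots,m_r)=\sum_{0\le n_1\le\cdots\le n_r}\frac{\mu^r}{(n_1\mu+m_1)^{k_1}\cdots(n_r\mu+m_r)^{k_r}}$. For $k_1,\dots,k_{r-1}\in\mathbb{N}$ and positive rationals $m_1,\dots,m_r,\tilde m_r$ with $m_r\neq\tilde m_r$, $\mathcal{D}^\mu(k_1,\dots,k_{r-1},1;m_1,\dots,m_r;m_1,\dots,m_{r-1},\tilde m_r)=(\tilde m_r-m_r)\sum_{0\le n_1\le\cdots\le n_r}\frac{\mu^r}{\prod_{i=1}^{r-1}(n_i\mu+m_i)^{k_i}\,(n_r\mu+m_r)(n_r\mu+\tilde m_r)}$. In particular $\mathcal{D}^\mu(1;m;n)=(n-m)\sum_{q\ge0}\frac{\mu}{(q\mu+m)(q\mu+n)}$. *)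

theory Defs
  imports "HOL-Analysis.Analysis"
begin

definition weak_chains :: "nat \<Rightarrow> nat list set" where
  "weak_chains r = {ns. length ns = r \<and> sorted ns}"

text \<open>The depth is \<open>r = length ks\<close>; \<open>ks\<close> and \<open>ms\<close> are meant to have equal length. Lists are
  0-based, so \<open>ks ! i\<close> is the (i+1)-st exponent. For positive exponents with the last one at
  least 2, positive shifts and \<open>Re \<mu> > 0\<close> the series converges absolutely, so the unordered
  sum is the ordinary one.\<close>

definition zeta_mu :: "complex \<Rightarrow> nat list \<Rightarrow> rat list \<Rightarrow> complex" where
  "zeta_mu \<mu> ks ms =
     (\<Sum>\<^sub>\<infinity>ns\<in>weak_chains (length ks).
        \<mu> ^ length ks / (\<Prod>i<length ks. (of_nat (ns ! i) * \<mu> + of_rat (ms ! i)) ^ (ks ! i)))"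

text \<open>Only for arguments with \<open>last ks = 1\<close> and \<open>butlast ms = butlast ms'\<close>, all three lists being
  nonempty and of equal length; the last exponent 1 and \<open>butlast ms'\<close> are therefore not used.\<close>

definition D_mu :: "complex \<Rightarrow> nat list \<Rightarrow> rat list \<Rightarrow> rat list \<Rightarrow> complex" where
  "D_mu \<mu> ks ms ms' =
     of_rat (last ms' - last ms) *
     (\<Sum>\<^sub>\<infinity>ns\<in>weak_chains (length ks).
        \<mu> ^ length ks /
        ((\<Prod>i<length ks - 1. (of_nat (ns ! i) * \<mu> + of_rat (ms ! i)) ^ (ks ! i)) *
         (of_nat (last ns) * \<mu> + of_rat (last ms)) *
         (of_nat (last ns) * \<mu> + of_rat (last ms'))))"

end

theory Submission
  imports Defs
begin

text \<open>Put \<open>a\<^sub>p = p\<mu> + n\<close>, \<open>c\<^sub>s = s\<mu> + m\<close> and \<open>b\<^sub>p\<^sub>+\<^sub>s = a\<^sub>p + c\<^sub>s\<close>, so that a term of \<open>\<zeta>\<^sup>\<mu>(j,k;n,m+n)\<close>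
  is \<open>\<mu>\<^sup>2 / (a\<^sub>p\<^sup>j b\<^sub>p\<^sub>+\<^sub>s\<^sup>k)\<close> with \<open>p, s \<ge> 0\<close> free. For \<open>b = a + c\<close> the geometric sum of
  \<open>1 / (a\<^sup>j b\<^sup>k)\<close> over \<open>j + k = N\<close>, \<open>j \<ge> 1\<close>, \<open>k \<ge> 2\<close>, equals
  \<open>a\<^bsup>-(N-1)\<^esup> (1/c - 1/b) - 1/(c b\<^bsup>N-1\<^esup>)\<close>. The last term sums to \<open>\<zeta>\<^sup>\<mu>(1,N-1;m,m+n)\<close>. In the first,
  replacing \<open>1/c\<^sub>s\<close> by \<open>1/c\<^sub>p\<^sub>+\<^sub>s\<close> yields \<open>\<D>\<^sup>\<mu>(N-1,1;n,m;n,m+n)\<close>, and the difference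
  \<open>\<Sum>\<^sub>s (1/c\<^sub>s - 1/c\<^sub>p\<^sub>+\<^sub>s)\<close> telescopes to the sum of \<open>1/c\<^sub>s\<close> over \<open>s < p\<close>, which gives
  \<open>\<zeta>\<^sup>\<mu>(1,N-1;m,n)\<close> without its diagonal. For \<open>m \<noteq> n\<close> the diagonal is evaluated by the same geometric
  sum, now with \<open>n - m\<close>, \<open>p\<mu> + m\<close> and \<open>p\<mu> + n\<close> in place of \<open>a\<close>, \<open>c\<close> and \<open>b\<close>.\<close>

section \<open>Infinite sums\<close>

lemma has_sum_diff:
  fixes f g :: "'a \<Rightarrow> 'b::topological_ab_group_add"
  assumes "(f has_sum x) A" "(g has_sum y) A"
  shows "((\<lambda>i. f i - g i) has_sum (x - y)) A"
  using has_sum_add[OF assms(1), of "\<lambda>i. - g i" "- y"] assms(2)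
  by (simp add: has_sum_uminus)

lemma has_sum_sum:
  fixes f :: "'a \<Rightarrow> 'b \<Rightarrow> 'c::topological_comm_monoid_add"
  assumes "\<And>i. i \<in> I \<Longrightarrow> (f i has_sum S i) A"
  shows "((\<lambda>x. \<Sum>i\<in>I. f i x) has_sum (\<Sum>i\<in>I. S i)) A"
  using assms by (induction I rule: infinite_finite_induct) (auto intro!: has_sum_add)

lemma sums_diff_shift:
  fixes f :: "nat \<Rightarrow> 'a::real_normed_vector"
  assumes "f \<longlonglongrightarrow> 0"
  shows "(\<lambda>s. f s - f (s + p)) sums (\<Sum>s<p. f s)"
proof (induction p)
  case 0
  show ?case by simp
next
  case (Suc p)
  have "(\<lambda>s. f (s + p)) \<longlonglongrightarrow> 0"
    using assms by (rule LIMSEQ_ignore_initial_segment)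
  from telescope_sums'[OF this] have "(\<lambda>s. f (s + p) - f (Suc s + p)) sums f p"
    by simp
  from sums_add[OF Suc.IH this] show ?case by simp
qed

lemma has_sum_telescope_rows:
  fixes u f :: "nat \<Rightarrow> 'a::{banach, real_normed_algebra}"
  assumes tendsto_0: "f \<longlonglongrightarrow> 0"
    and has_sum_pairs: "((\<lambda>(p, s). u p * (f s - f (p + s))) has_sum S) UNIV"
  shows "((\<lambda>p. u p * (\<Sum>s<p. f s)) has_sum S) UNIV"
proof (rule has_sum_SigmaD)
  show "((\<lambda>(p, s). u p * (f s - f (p + s))) has_sum S) (UNIV \<times> UNIV)"
    using has_sum_pairs by simp
  fix p
  have "(\<lambda>(p, s). u p * (f s - f (p + s))) summable_on range (Pair p)"
    using has_sum_imp_summable[OF has_sum_pairs] by (rule summable_on_subset_banach) simp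
  hence "(\<lambda>s. u p * (f s - f (p + s))) summable_on UNIV"
    by (simp add: summable_on_reindex inj_on_def o_def)
  hence row_has_sum: "((\<lambda>s. u p * (f s - f (p + s))) has_sum (\<Sum>\<^sub>\<infinity>s. u p * (f s - f (p + s)))) UNIV"
    by (rule has_sum_infsum)
  have "(\<lambda>s. u p * (f s - f (p + s))) sums (u p * (\<Sum>s<p. f s))"
    using sums_mult[OF sums_diff_shift[OF tendsto_0, of p], of "u p"] by (simp add: add.commute)
  with row_has_sum show "((\<lambda>s. case (p, s) of (p, s) \<Rightarrow> u p * (f s - f (p + s)))
                   has_sum (u p * (\<Sum>s<p. f s))) UNIV"
    using has_sum_imp_sums sums_unique2 by fastforce
qed

lemma has_sum_triangle:
  fixes F :: "nat \<Rightarrow> nat \<Rightarrow> 'a::{topological_comm_monoid_add, t3_space}"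
  assumes "((\<lambda>(p, t). F p (p + t)) has_sum S) UNIV"
  shows "((\<lambda>q. \<Sum>p\<le>q. F p q) has_sum S) UNIV"
proof (rule has_sum_SigmaD)
  have "((\<lambda>(p, t). F p (p + t)) has_sum S) UNIV \<longleftrightarrow>
        ((\<lambda>(q, p). F p q) has_sum S) (SIGMA q:UNIV. {..q})"
    by (rule has_sum_reindex_bij_witness[of _ "\<lambda>(q, p). (p, q - p)" "\<lambda>(p, t). (p + t, p)"]) auto
  with assms show "((\<lambda>(q, p). F p q) has_sum S) (SIGMA q:UNIV. {..q})"
    by simp
qed auto

lemma summable_on_inverse_square_bound:
  fixes v :: "nat \<Rightarrow> 'a::banach"
  assumes "\<And>q. norm (v q) \<le> B / real (Suc q) ^ 2"
  shows "v summable_on UNIV"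
proof (rule norm_summable_imp_summable_on)
  have "summable (\<lambda>q. B * inverse (real (Suc q) ^ 2))"
    by (intro summable_mult) (subst summable_Suc_iff, simp add: inverse_power_summable)
  thus "summable (\<lambda>q. norm (v q))"
    by (rule summable_comparison_test'[where N = 0]) (use assms in \<open>simp add: field_simps\<close>)
qed

text \<open>Moves half a power of \<open>t\<close> to \<open>u\<close>: for \<open>t = u + v - 1\<close> this bounds \<open>1 / (u t\<^sup>2)\<close> by a product of
  terms of two convergent series.\<close>

lemma powr_three_halves_mult_le:
  fixes u v t :: real
  assumes "0 < u" "0 < v" "u \<le> t" "v \<le> t"
  shows "u powr (3/2) * v powr (3/2) \<le> u * t\<^sup>2"
proof -
  have "u powr (3/2) * v powr (3/2) = u * (u powr (1/2) * v powr (3/2))"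
    using assms powr_add[of u 1 "1/2"] by simp
  also have "\<dots> \<le> u * (t powr (1/2) * t powr (3/2))"
    using assms by (intro mult_left_mono mult_mono powr_mono2) auto
  also have "t powr (1/2) * t powr (3/2) = t\<^sup>2"
    using assms by (simp flip: powr_add)
  finally show ?thesis .
qed

lemma summable_on_inverse_powr_pairs:
  fixes a :: real
  assumes "1 < a"
  shows "(\<lambda>(p, t). 1 / (real (Suc p) powr a * real (Suc t) powr a)) summable_on UNIV"
proof -
  define w where "w p = 1 / real (Suc p) powr a" for p
  have "summable (\<lambda>p. real p powr (- a))"
    using assms by (subst summable_real_powr_iff) auto
  hence "summable w"
    unfolding w_def by (subst (asm) summable_Suc_iff[symmetric]) (simp only: powr_minus_divide)
  hence w_has_sum: "(w has_sum infsum w UNIV) UNIV"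
    by (subst has_sum_infsum) (auto simp: summable_on_UNIV_nonneg_real_iff w_def)
  have "(\<lambda>(p, t). w p * w t) summable_on UNIV \<times> UNIV"
  proof (rule summable_on_SigmaI)
    show "((\<lambda>t. case (p, t) of (p, t) \<Rightarrow> w p * w t) has_sum (w p * infsum w UNIV)) UNIV" for p
      using has_sum_cmult_right[OF w_has_sum] by simp
    show "(\<lambda>p. w p * infsum w UNIV) summable_on UNIV"
      using has_sum_imp_summable[OF w_has_sum] by (rule summable_on_cmult_left)
  qed (auto simp: w_def)
  thus ?thesis
    by (simp add: w_def)
qed

lemma summable_on_mult_shift:
  fixes u v :: "nat \<Rightarrow> 'a::{banach, real_normed_algebra}"
  assumes u_le: "\<And>p. norm (u p) \<le> A / real (Suc p)"
    and v_le: "\<And>q. norm (v q) \<le> B / real (Suc q) ^ 2"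
  shows "(\<lambda>(p, t). u p * v (p + t)) summable_on UNIV"
proof -
  have nonneg: "0 \<le> A" "0 \<le> B"
    using order_trans[OF norm_ge_zero u_le[of 0]] order_trans[OF norm_ge_zero v_le[of 0]]
    by simp_all
  have norm_le: "norm (u p * v (p + t)) \<le>
      A * B * (1 / (real (Suc p) powr (3/2) * real (Suc t) powr (3/2)))" for p t
  proof -
    have "norm (u p * v (p + t)) \<le> norm (u p) * norm (v (p + t))"
      by (rule norm_mult_ineq)
    also have "\<dots> \<le> A / real (Suc p) * (B / real (Suc (p + t)) ^ 2)"
      using nonneg by (intro mult_mono u_le v_le) auto
    also have "\<dots> = A * B / (real (Suc p) * real (Suc (p + t)) ^ 2)"
      by simp
    also have "\<dots> \<le> A * B / (real (Suc p) powr (3/2) * real (Suc t) powr (3/2))"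
      using nonneg by (intro divide_left_mono powr_three_halves_mult_le) auto
    finally show ?thesis
      by simp
  qed
  have "(\<lambda>x. A * B * (case x of (p, t) \<Rightarrow>
           1 / (real (Suc p) powr (3/2) * real (Suc t) powr (3/2)))) summable_on UNIV"
    by (intro summable_on_cmult_right summable_on_inverse_powr_pairs) simp
  hence "(\<lambda>x. norm (case x of (p, t) \<Rightarrow> u p * v (p + t))) summable_on UNIV"
    by (rule Infinite_Sum.abs_summable_on_comparison_test') (use norm_le in auto)
  thus ?thesis
    by (rule abs_summable_summable)
qed

section \<open>Sums over admissible exponents\<close>

definition admissible_pairs :: "nat \<Rightarrow> (nat \<times> nat) set" where
  "admissible_pairs N = {(j, k). j + k = N \<and> j \<ge> 1 \<and> k \<ge> 2}"

lemma sum_admissible_pairs_shift: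
  "(\<Sum>(i, k)\<in>{(i, k). i + k = N - 2 \<and> i \<ge> 1 \<and> k \<ge> (0::nat)}. f i (k + 2)) =
   (\<Sum>(j, k)\<in>admissible_pairs N. f j k)"
  by (rule sum.reindex_bij_witness[of _ "\<lambda>(j, k). (j, k - 2)" "\<lambda>(i, k). (i, k + 2)"])
     (auto simp: admissible_pairs_def)

lemma sum_admissible_pairs_eq:
  "(\<Sum>(j, k)\<in>admissible_pairs N. f j k) = (\<Sum>j=1..N - 2. f j (N - j))"
  by (rule sum.reindex_bij_witness[of _ "\<lambda>j. (j, N - j)" fst]) (auto simp: admissible_pairs_def)

lemma sum_admissible_pairs_Suc:
  assumes "2 \<le> N"
  shows "(\<Sum>(j, k)\<in>admissible_pairs (Suc N). f j k) =
         (\<Sum>(j, k)\<in>admissible_pairs N. f j (Suc k)) + f (N - 1) 2"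
proof -
  obtain M where "N = M + 2"
    using assms by (metis le_add_diff_inverse2)
  thus ?thesis
    unfolding sum_admissible_pairs_eq by (simp add: Suc_diff_le numeral_2_eq_2)
qed

lemma sum_admissible_partial_fraction:
  fixes a b c z :: "'a::field"
  assumes nonzero: "a \<noteq> 0" "b \<noteq> 0" "c \<noteq> 0" and b_eq: "b = a + c" and "2 \<le> N"
  shows "(\<Sum>(j, k)\<in>admissible_pairs N. z / (a ^ j * b ^ k)) + z / (c * b ^ (N - 1)) =
         z / a ^ (N - 1) * (1 / c - 1 / b)"
  using \<open>2 \<le> N\<close>
proof (induction N rule: dec_induct)
  case base
  have "admissible_pairs 2 = {}"
    by (auto simp: admissible_pairs_def)
  thus ?case
    using nonzero by (simp add: b_eq diff_frac_eq)
next
  case (step N)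
  let ?S = "\<lambda>N. \<Sum>(j, k)\<in>admissible_pairs N. z / (a ^ j * b ^ k)"
  have "?S (Suc N) = ?S N / b + z / (a ^ (N - 1) * b\<^sup>2)"
    unfolding sum_admissible_pairs_Suc[OF step.hyps(1), of "\<lambda>j k. z / (a ^ j * b ^ k)"]
    by (simp add: sum_divide_distrib case_prod_unfold mult_ac)
  moreover have "z / (c * b ^ (Suc N - 1)) = z / (c * b ^ (N - 1)) / b"
    using step.hyps(1) by (cases N) auto
  ultimately have "?S (Suc N) + z / (c * b ^ (Suc N - 1)) =
      (?S N + z / (c * b ^ (N - 1))) / b + z / (a ^ (N - 1) * b\<^sup>2)"
    by (simp add: add_divide_distrib)
  also have "\<dots> = z / a ^ (N - 1) * ((1 / c - 1 / b) / b + 1 / b\<^sup>2)"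
    by (subst step.IH) (simp add: distrib_left)
  also have "(1 / c - 1 / b) / b + 1 / b\<^sup>2 = 1 / a * (1 / c - 1 / b)"
    using nonzero by (simp add: field_simps power2_eq_square) (simp add: b_eq algebra_simps)
  also have "z / a ^ (N - 1) * (1 / a * (1 / c - 1 / b)) = z / a ^ (Suc N - 1) * (1 / c - 1 / b)"
    using step.hyps(1) by (cases N) auto
  finally show ?case .
qed

section \<open>Arithmetic progressions in the right half-plane\<close>

definition arith_prog :: "complex \<Rightarrow> complex \<Rightarrow> nat \<Rightarrow> complex" where
  "arith_prog \<mu> \<alpha> p = of_nat p * \<mu> + \<alpha>"

lemma arith_prog_add: "arith_prog \<mu> (\<alpha> + \<beta>) (p + q) = arith_prog \<mu> \<alpha> p + arith_prog \<mu> \<beta> q"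
  by (simp add: arith_prog_def algebra_simps)

lemma norm_arith_prog_ge:
  assumes "0 \<le> c" "c \<le> Re \<mu>" "c \<le> Re \<alpha>"
  shows "c * real (Suc p) \<le> norm (arith_prog \<mu> \<alpha> p)"
proof -
  have "c * real (Suc p) = real p * c + c"
    by (simp add: algebra_simps)
  also have "\<dots> \<le> Re (arith_prog \<mu> \<alpha> p)"
    using assms by (simp add: arith_prog_def add_mono mult_left_mono)
  also have "\<dots> \<le> norm (arith_prog \<mu> \<alpha> p)"
    by (rule complex_Re_le_cmod)
  finally show ?thesis .
qed

lemma arith_prog_nonzero:
  assumes "0 < Re \<mu>" "0 < Re \<alpha>"
  shows "arith_prog \<mu> \<alpha> p \<noteq> 0"
proof -
  have "0 < Re (arith_prog \<mu> \<alpha> p)"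
    using assms by (simp add: arith_prog_def add_nonneg_pos)
  thus ?thesis by auto
qed

lemma norm_inverse_arith_prog_le:
  assumes "0 < Re \<mu>" "0 < Re \<alpha>" "0 < Re \<beta>" "i \<le> j + k"
  shows "\<exists>C. \<forall>p. norm (1 / (arith_prog \<mu> \<alpha> p ^ j * arith_prog \<mu> \<beta> p ^ k)) \<le> C / real (Suc p) ^ i"
proof (intro exI allI)
  define c where "c = min (Re \<mu>) (min (Re \<alpha>) (Re \<beta>))"
  have c_bounds: "0 < c" "c \<le> Re \<mu>" "c \<le> Re \<alpha>" "c \<le> Re \<beta>"
    using assms by (auto simp: c_def)
  fix p
  have "c ^ (j + k) * real (Suc p) ^ i \<le> c ^ (j + k) * real (Suc p) ^ (j + k)"
    using c_bounds assms(4) by (intro mult_left_mono power_increasing) auto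
  also have "\<dots> = (c * real (Suc p)) ^ j * (c * real (Suc p)) ^ k"
    by (simp only: power_add power_mult_distrib mult_ac)
  also have "\<dots> \<le> norm (arith_prog \<mu> \<alpha> p) ^ j * norm (arith_prog \<mu> \<beta> p) ^ k"
    using c_bounds by (intro mult_mono power_mono norm_arith_prog_ge) auto
  finally have "1 / (norm (arith_prog \<mu> \<alpha> p) ^ j * norm (arith_prog \<mu> \<beta> p) ^ k) \<le>
                1 / (c ^ (j + k) * real (Suc p) ^ i)"
    using c_bounds by (intro frac_le) auto
  thus "norm (1 / (arith_prog \<mu> \<alpha> p ^ j * arith_prog \<mu> \<beta> p ^ k)) \<le>
        1 / c ^ (j + k) / real (Suc p) ^ i"
    by (simp add: norm_divide norm_mult norm_power)
qed

lemma norm_inverse_arith_prog_power_le: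
  assumes "0 < Re \<mu>" "0 < Re \<alpha>" "i \<le> k"
  shows "\<exists>C. \<forall>p. norm (1 / arith_prog \<mu> \<alpha> p ^ k) \<le> C / real (Suc p) ^ i"
  using norm_inverse_arith_prog_le[OF assms(1,2,2), of i k 0] assms(3) by simp

lemma inverse_arith_prog_tendsto_0:
  assumes "0 < Re \<mu>" "0 < Re \<alpha>"
  shows "(\<lambda>p. 1 / arith_prog \<mu> \<alpha> p) \<longlonglongrightarrow> 0"
proof -
  obtain C where "\<forall>p. norm (1 / arith_prog \<mu> \<alpha> p ^ 1) \<le> C / real (Suc p) ^ 1"
    using norm_inverse_arith_prog_power_le[OF assms order_refl] ..
  hence "\<forall>\<^sub>F p in sequentially. norm (1 / arith_prog \<mu> \<alpha> p) \<le> C / real (Suc p)"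
    by simp
  moreover have "(\<lambda>p. C / real (Suc p)) \<longlonglongrightarrow> 0"
    by (rule LIMSEQ_Suc[OF lim_const_over_n])
  ultimately show ?thesis
    by (rule Lim_null_comparison)
qed

lemma summable_on_inverse_arith_prog:
  assumes "0 < Re \<mu>" "0 < Re \<alpha>" "0 < Re \<beta>" "2 \<le> j + k"
  shows "(\<lambda>p. 1 / (arith_prog \<mu> \<alpha> p ^ j * arith_prog \<mu> \<beta> p ^ k)) summable_on UNIV"
proof -
  obtain B where
    "\<forall>p. norm (1 / (arith_prog \<mu> \<alpha> p ^ j * arith_prog \<mu> \<beta> p ^ k)) \<le> B / real (Suc p) ^ 2"
    using norm_inverse_arith_prog_le[OF assms] ..
  thus ?thesis
    by (intro summable_on_inverse_square_bound) (rule spec)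
qed

lemma summable_on_inverse_arith_prog_pairs:
  assumes "0 < Re \<mu>" "0 < Re \<alpha>" "0 < Re \<beta>" "0 < Re \<gamma>" "1 \<le> j" "2 \<le> k + l"
  shows "(\<lambda>(p, t). 1 / arith_prog \<mu> \<alpha> p ^ j *
           (1 / (arith_prog \<mu> \<beta> (p + t) ^ k * arith_prog \<mu> \<gamma> (p + t) ^ l))) summable_on UNIV"
proof -
  obtain A where A_bound: "\<forall>p. norm (1 / arith_prog \<mu> \<alpha> p ^ j) \<le> A / real (Suc p) ^ 1"
    using norm_inverse_arith_prog_power_le[OF assms(1,2,5)] ..
  obtain B where B_bound:
    "\<forall>q. norm (1 / (arith_prog \<mu> \<beta> q ^ k * arith_prog \<mu> \<gamma> q ^ l)) \<le> B / real (Suc q) ^ 2"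
    using norm_inverse_arith_prog_le[OF assms(1,3,4,6)] ..
  show ?thesis
    by (rule summable_on_mult_shift[OF spec[OF A_bound[unfolded power_one_right]] spec[OF B_bound]])
qed

lemma Re_of_rat: "Re (of_rat r) = of_rat r"
proof -
  have "of_rat r = complex_of_real (of_rat r)"
    by (cases r) (simp add: of_rat_rat)
  thus ?thesis by simp
qed

section \<open>The series of depth one and two\<close>

lemma infsum_weak_chains_1: "infsum F (weak_chains 1) = (\<Sum>\<^sub>\<infinity>p. F [p])"
  by (rule infsum_reindex_bij_witness[of _ "\<lambda>p. [p]" hd])
     (auto simp: weak_chains_def length_Suc_conv)

lemma infsum_weak_chains_2: "infsum F (weak_chains 2) = (\<Sum>\<^sub>\<infinity>(p, t). F [p, p + t])"
  by (rule infsum_reindex_bij_witness[of _ "\<lambda>(p, t). [p, p + t]" "\<lambda>ns. (ns ! 0, ns ! 1 - ns ! 0)"])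
     (auto simp: weak_chains_def length_Suc_conv numeral_2_eq_2)

definition zeta_mu_diagonal :: "complex \<Rightarrow> nat \<Rightarrow> rat \<Rightarrow> rat \<Rightarrow> complex" where
  "zeta_mu_diagonal \<mu> k m n =
     (\<Sum>\<^sub>\<infinity>p. \<mu>\<^sup>2 / (arith_prog \<mu> (of_rat m) p * arith_prog \<mu> (of_rat n) p ^ k))"

context
  fixes \<mu> :: complex
  assumes Re_mu_pos: "0 < Re \<mu>"
begin

lemma arith_prog_of_rat_nonzero: "0 < r \<Longrightarrow> arith_prog \<mu> (of_rat r) p \<noteq> 0"
  by (simp add: arith_prog_nonzero Re_mu_pos Re_of_rat)

lemma zeta_mu_1_has_sum:
  assumes "0 < n" "2 \<le> k"
  shows "((\<lambda>p. \<mu> / arith_prog \<mu> (of_rat n) p ^ k) has_sum zeta_mu \<mu> [k] [n]) UNIV"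
proof -
  have "(\<lambda>p. \<mu> * (1 / (arith_prog \<mu> (of_rat n) p ^ k * arith_prog \<mu> (of_rat n) p ^ 0)))
          summable_on UNIV"
    using assms by (intro summable_on_cmult_right summable_on_inverse_arith_prog Re_mu_pos)
                   (auto simp: Re_of_rat)
  moreover have "zeta_mu \<mu> [k] [n] = (\<Sum>\<^sub>\<infinity>p. \<mu> / arith_prog \<mu> (of_rat n) p ^ k)"
    unfolding zeta_mu_def by (simp add: infsum_weak_chains_1[simplified] arith_prog_def)
  ultimately show ?thesis by simp
qed

lemma zeta_mu_2_has_sum:
  assumes "0 < m" "0 < n" "1 \<le> j" "2 \<le> k"
  shows "((\<lambda>(p, t). \<mu>\<^sup>2 / (arith_prog \<mu> (of_rat m) p ^ j * arith_prog \<mu> (of_rat n) (p + t) ^ k))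
           has_sum zeta_mu \<mu> [j, k] [m, n]) UNIV"
proof -
  have "(\<lambda>x. \<mu>\<^sup>2 * (case x of (p, t) \<Rightarrow> 1 / arith_prog \<mu> (of_rat m) p ^ j *
           (1 / (arith_prog \<mu> (of_rat n) (p + t) ^ k * arith_prog \<mu> (of_rat n) (p + t) ^ 0))))
          summable_on UNIV"
    using assms by (intro summable_on_cmult_right summable_on_inverse_arith_prog_pairs Re_mu_pos)
                   (auto simp: Re_of_rat)
  moreover have "zeta_mu \<mu> [j, k] [m, n] = (\<Sum>\<^sub>\<infinity>(p, t).
      \<mu>\<^sup>2 / (arith_prog \<mu> (of_rat m) p ^ j * arith_prog \<mu> (of_rat n) (p + t) ^ k))"
    unfolding zeta_mu_def
    by (simp add: infsum_weak_chains_2[unfolded numeral_2_eq_2] numeral_2_eq_2 arith_prog_def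
          lessThan_Suc mult.commute)
  ultimately show ?thesis by (simp add: case_prod_unfold)
qed

lemma inverse_arith_prog_diff:
  assumes "0 < m" "0 < n"
  shows "1 / arith_prog \<mu> (of_rat m) p - 1 / arith_prog \<mu> (of_rat n) p =
         of_rat (n - m) / (arith_prog \<mu> (of_rat m) p * arith_prog \<mu> (of_rat n) p)"
  using assms arith_prog_of_rat_nonzero[of m p] arith_prog_of_rat_nonzero[of n p]
  by (simp add: diff_frac_eq arith_prog_def of_rat_diff)

lemma D_mu_1_has_sum:
  assumes "0 < m" "0 < n"
  shows "((\<lambda>p. \<mu> * (1 / arith_prog \<mu> (of_rat m) p - 1 / arith_prog \<mu> (of_rat n) p))
           has_sum D_mu \<mu> [1] [m] [n]) UNIV"
proof -
  have "(\<lambda>p. \<mu> * of_rat (n - m) *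
           (1 / (arith_prog \<mu> (of_rat m) p ^ 1 * arith_prog \<mu> (of_rat n) p ^ 1)))
          summable_on UNIV"
    using assms by (intro summable_on_cmult_right summable_on_inverse_arith_prog Re_mu_pos)
                   (auto simp: Re_of_rat)
  moreover have "D_mu \<mu> [1] [m] [n] =
      (\<Sum>\<^sub>\<infinity>p. \<mu> * (of_rat (n - m) / (arith_prog \<mu> (of_rat m) p * arith_prog \<mu> (of_rat n) p)))"
    unfolding D_mu_def
    by (simp add: infsum_weak_chains_1[simplified] arith_prog_def mult_ac
          flip: infsum_cmult_right')
  ultimately show ?thesis by (simp add: inverse_arith_prog_diff[OF assms])
qed

lemma D_mu_2_has_sum:
  assumes "0 < l" "0 < m" "0 < n" "1 \<le> j"
  shows "((\<lambda>(p, t). \<mu>\<^sup>2 / arith_prog \<mu> (of_rat l) p ^ j *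
             (1 / arith_prog \<mu> (of_rat m) (p + t) - 1 / arith_prog \<mu> (of_rat n) (p + t)))
           has_sum D_mu \<mu> [j, 1] [l, m] [l, n]) UNIV"
proof -
  have "(\<lambda>x. \<mu>\<^sup>2 * of_rat (n - m) * (case x of (p, t) \<Rightarrow> 1 / arith_prog \<mu> (of_rat l) p ^ j *
           (1 / (arith_prog \<mu> (of_rat m) (p + t) ^ 1 * arith_prog \<mu> (of_rat n) (p + t) ^ 1))))
          summable_on UNIV"
    using assms by (intro summable_on_cmult_right summable_on_inverse_arith_prog_pairs Re_mu_pos)
                   (auto simp: Re_of_rat)
  moreover have "D_mu \<mu> [j, 1] [l, m] [l, n] = (\<Sum>\<^sub>\<infinity>(p, t). \<mu>\<^sup>2 / arith_prog \<mu> (of_rat l) p ^ j *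
      (of_rat (n - m) / (arith_prog \<mu> (of_rat m) (p + t) * arith_prog \<mu> (of_rat n) (p + t))))"
    unfolding D_mu_def
    by (simp add: infsum_weak_chains_2[unfolded numeral_2_eq_2] numeral_2_eq_2 arith_prog_def
          case_prod_unfold mult_ac flip: infsum_cmult_right')
  ultimately show ?thesis
    by (simp add: inverse_arith_prog_diff[OF assms(2,3)] case_prod_unfold)
qed

section \<open>The sum formula\<close>

lemma zeta_mu_minus_diagonal_has_sum:
  assumes "0 < m" "0 < n" "2 \<le> k"
  shows "((\<lambda>q. \<mu>\<^sup>2 / arith_prog \<mu> (of_rat n) q ^ k * (\<Sum>p<q. 1 / arith_prog \<mu> (of_rat m) p))
           has_sum (zeta_mu \<mu> [1, k] [m, n] - zeta_mu_diagonal \<mu> k m n)) UNIV"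
proof -
  define x where "x = arith_prog \<mu> (of_rat m)"
  define y where "y = arith_prog \<mu> (of_rat n)"
  have "((\<lambda>q. \<Sum>p\<le>q. \<mu>\<^sup>2 / (x p ^ 1 * y q ^ k)) has_sum zeta_mu \<mu> [1, k] [m, n]) UNIV"
    unfolding x_def y_def using assms by (intro has_sum_triangle zeta_mu_2_has_sum) auto
  moreover have "(\<lambda>p. \<mu>\<^sup>2 * (1 / (x p ^ 1 * y p ^ k))) summable_on UNIV"
    unfolding x_def y_def using assms
    by (intro summable_on_cmult_right summable_on_inverse_arith_prog Re_mu_pos)
       (auto simp: Re_of_rat)
  hence "((\<lambda>p. \<mu>\<^sup>2 / (x p * y p ^ k)) has_sum zeta_mu_diagonal \<mu> k m n) UNIV"
    by (simp add: zeta_mu_diagonal_def x_def y_def)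
  ultimately have "((\<lambda>q. (\<Sum>p\<le>q. \<mu>\<^sup>2 / (x p ^ 1 * y q ^ k)) - \<mu>\<^sup>2 / (x q * y q ^ k)) has_sum
      (zeta_mu \<mu> [1, k] [m, n] - zeta_mu_diagonal \<mu> k m n)) UNIV"
    by (rule has_sum_diff)
  moreover have "(\<Sum>p\<le>q. \<mu>\<^sup>2 / (x p ^ 1 * y q ^ k)) - \<mu>\<^sup>2 / (x q * y q ^ k) =
                 \<mu>\<^sup>2 / y q ^ k * (\<Sum>p<q. 1 / x p)" for q
    by (simp add: sum_distrib_left sum_divide_distrib mult.commute flip: lessThan_Suc_atMost)
  ultimately show ?thesis
    by (simp add: x_def y_def)
qed

lemma sum_zeta_mu_has_sum:
  assumes "0 < m" "0 < n" "3 \<le> N"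
  shows "((\<lambda>(p, s). \<mu>\<^sup>2 / arith_prog \<mu> (of_rat n) p ^ (N - 1) *
             (1 / arith_prog \<mu> (of_rat m) s - 1 / arith_prog \<mu> (of_rat (m + n)) (p + s)))
           has_sum ((\<Sum>(j, k)\<in>admissible_pairs N. zeta_mu \<mu> [j, k] [n, m + n])
                    + zeta_mu \<mu> [1, N - 1] [m, m + n])) UNIV"
proof -
  define a where "a = arith_prog \<mu> (of_rat n)"
  define b where "b = arith_prog \<mu> (of_rat (m + n))"
  define c where "c = arith_prog \<mu> (of_rat m)"
  have m_plus_n_pos: "0 < m + n"
    using assms by simp
  have "((\<lambda>x. \<Sum>(j, k)\<in>admissible_pairs N. case x of (p, s) \<Rightarrow> \<mu>\<^sup>2 / (a p ^ j * b (p + s) ^ k))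
          has_sum (\<Sum>(j, k)\<in>admissible_pairs N. zeta_mu \<mu> [j, k] [n, m + n])) UNIV"
    unfolding a_def b_def case_prod_unfold
    by (intro has_sum_sum zeta_mu_2_has_sum[unfolded case_prod_unfold] m_plus_n_pos assms)
       (auto simp: admissible_pairs_def)
  moreover have "((\<lambda>(p, s). \<mu>\<^sup>2 / (c s * b (p + s) ^ (N - 1)))
      has_sum zeta_mu \<mu> [1, N - 1] [m, m + n]) (UNIV \<times> UNIV)"
    unfolding b_def c_def using zeta_mu_2_has_sum[OF assms(1) m_plus_n_pos, of 1 "N - 1"] assms(3)
    by (subst has_sum_swap) (simp add: case_prod_unfold add.commute)
  ultimately have "((\<lambda>x. (\<Sum>(j, k)\<in>admissible_pairs N.
          case x of (p, s) \<Rightarrow> \<mu>\<^sup>2 / (a p ^ j * b (p + s) ^ k))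
        + (case x of (p, s) \<Rightarrow> \<mu>\<^sup>2 / (c s * b (p + s) ^ (N - 1))))
      has_sum ((\<Sum>(j, k)\<in>admissible_pairs N. zeta_mu \<mu> [j, k] [n, m + n])
               + zeta_mu \<mu> [1, N - 1] [m, m + n])) UNIV"
    by (intro has_sum_add) simp_all
  moreover have "(\<Sum>(j, k)\<in>admissible_pairs N. \<mu>\<^sup>2 / (a p ^ j * b (p + s) ^ k))
        + \<mu>\<^sup>2 / (c s * b (p + s) ^ (N - 1)) =
      \<mu>\<^sup>2 / a p ^ (N - 1) * (1 / c s - 1 / b (p + s))" for p s
  proof (rule sum_admissible_partial_fraction)
    show "b (p + s) = a p + c s"
      by (simp add: a_def b_def c_def of_rat_add add.commute flip: arith_prog_add)
  qed (use assms in \<open>auto simp: a_def b_def c_def arith_prog_of_rat_nonzero\<close>)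
  ultimately show ?thesis
    by (simp add: a_def b_def c_def case_prod_unfold)
qed

lemma sum_zeta_mu_admissible_pairs:
  assumes "0 < m" "0 < n" "3 \<le> N"
  shows "(\<Sum>(j, k)\<in>admissible_pairs N. zeta_mu \<mu> [j, k] [n, m + n]) =
           zeta_mu \<mu> [1, N - 1] [m, n] - zeta_mu \<mu> [1, N - 1] [m, m + n]
           + D_mu \<mu> [N - 1, 1] [n, m] [n, m + n] - zeta_mu_diagonal \<mu> (N - 1) m n"
    (is "?L = ?Z - ?Y + ?D - ?W")
proof -
  define u where "u p = \<mu>\<^sup>2 / arith_prog \<mu> (of_rat n) p ^ (N - 1)" for p
  define f where "f p = 1 / arith_prog \<mu> (of_rat m) p" for p
  define g where "g p = 1 / arith_prog \<mu> (of_rat (m + n)) p" for p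
  have "((\<lambda>(p, s). u p * (f s - g (p + s))) has_sum (?L + ?Y)) UNIV"
    unfolding u_def f_def g_def by (rule sum_zeta_mu_has_sum[OF assms])
  moreover have "((\<lambda>(p, s). u p * (f (p + s) - g (p + s))) has_sum ?D) UNIV"
    unfolding u_def f_def g_def using assms by (intro D_mu_2_has_sum) auto
  ultimately have "((\<lambda>x. (case x of (p, s) \<Rightarrow> u p * (f s - g (p + s)))
      - (case x of (p, s) \<Rightarrow> u p * (f (p + s) - g (p + s)))) has_sum (?L + ?Y - ?D)) UNIV"
    by (rule has_sum_diff)
  hence "((\<lambda>(p, s). u p * (f s - f (p + s))) has_sum (?L + ?Y - ?D)) UNIV"
    by (simp add: case_prod_unfold flip: right_diff_distrib)
  moreover have "f \<longlonglongrightarrow> 0"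
    unfolding f_def using assms
    by (intro inverse_arith_prog_tendsto_0 Re_mu_pos) (simp add: Re_of_rat)
  ultimately have "((\<lambda>p. u p * (\<Sum>s<p. f s)) has_sum (?L + ?Y - ?D)) UNIV"
    by (intro has_sum_telescope_rows)
  moreover have "((\<lambda>p. u p * (\<Sum>s<p. f s)) has_sum (?Z - ?W)) UNIV"
    unfolding u_def f_def using assms by (intro zeta_mu_minus_diagonal_has_sum) auto
  ultimately have "?L + ?Y - ?D = ?Z - ?W"
    by (rule has_sum_unique)
  thus ?thesis
    by (simp add: algebra_simps)
qed

lemma zeta_mu_diagonal_same:
  assumes "0 < n" "1 \<le> k"
  shows "zeta_mu_diagonal \<mu> k n n = \<mu> * zeta_mu \<mu> [Suc k] [n]"
proof -
  have "((\<lambda>p. \<mu> * (\<mu> / arith_prog \<mu> (of_rat n) p ^ Suc k)) has_sum \<mu> * zeta_mu \<mu> [Suc k] [n]) UNIV"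
    using assms by (intro has_sum_cmult_right zeta_mu_1_has_sum) auto
  thus ?thesis
    unfolding zeta_mu_diagonal_def by (intro infsumI) (simp add: power2_eq_square)
qed

lemma zeta_mu_diagonal_distinct:
  assumes "0 < m" "0 < n" "m \<noteq> n" "2 \<le> N"
  shows "zeta_mu_diagonal \<mu> (N - 1) m n = \<mu> * (D_mu \<mu> [1] [m] [n] / of_rat (n - m) ^ (N - 1))
           - \<mu> * (\<Sum>(i, k)\<in>admissible_pairs N. zeta_mu \<mu> [k] [n] / of_rat (n - m) ^ i)"
    (is "_ = ?rhs")
proof -
  define d :: complex where "d = of_rat (n - m)"
  define x where "x = arith_prog \<mu> (of_rat m)"
  define y where "y = arith_prog \<mu> (of_rat n)"
  have "((\<lambda>p. \<mu> * (\<mu> * (1 / x p - 1 / y p) / d ^ (N - 1))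
            - \<mu> * (\<Sum>(i, k)\<in>admissible_pairs N. \<mu> / y p ^ k / d ^ i)) has_sum ?rhs) UNIV"
    unfolding x_def y_def d_def case_prod_unfold
    by (intro has_sum_diff has_sum_cmult_right has_sum_divide_const has_sum_sum D_mu_1_has_sum
          zeta_mu_1_has_sum assms) (auto simp: admissible_pairs_def)
  moreover have "\<mu> * (\<mu> * (1 / x p - 1 / y p) / d ^ (N - 1))
      - \<mu> * (\<Sum>(i, k)\<in>admissible_pairs N. \<mu> / y p ^ k / d ^ i) = \<mu>\<^sup>2 / (x p * y p ^ (N - 1))" for p
  proof -
    have "d \<noteq> 0" "y p = d + x p"
      using assms by (auto simp: d_def x_def y_def arith_prog_def of_rat_diff)
    hence "(\<Sum>(i, k)\<in>admissible_pairs N. \<mu>\<^sup>2 / (d ^ i * y p ^ k)) + \<mu>\<^sup>2 / (x p * y p ^ (N - 1)) =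
           \<mu>\<^sup>2 / d ^ (N - 1) * (1 / x p - 1 / y p)"
      using assms unfolding x_def y_def
      by (intro sum_admissible_partial_fraction arith_prog_of_rat_nonzero) auto
    thus ?thesis
      by (simp add: sum_distrib_left case_prod_unfold power2_eq_square diff_divide_distrib
            algebra_simps)
  qed
  ultimately show ?thesis
    unfolding zeta_mu_diagonal_def by (intro infsumI) (simp add: x_def y_def)
qed

end

theorem theorem5p3:
  fixes \<mu> :: complex
  assumes "Re \<mu> > 0"
  shows "(\<forall>(m::rat) (n::rat) (N::nat). m > 0 \<longrightarrow> n > 0 \<longrightarrow> m \<noteq> n \<longrightarrow> N \<ge> 3 \<longrightarrow>
      (\<Sum>(j, k)\<in>{(j, k). j + k = N \<and> j \<ge> 1 \<and> k \<ge> 2}. zeta_mu \<mu> [j, k] [n, m + n]) =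
        zeta_mu \<mu> [1, N - 1] [m, n] - zeta_mu \<mu> [1, N - 1] [m, m + n]
        - \<mu> * (D_mu \<mu> [1] [m] [n] / of_rat (n - m) ^ (N - 1))
        + D_mu \<mu> [N - 1, 1] [n, m] [n, m + n]
        + \<mu> * (\<Sum>(i, k)\<in>{(i, k). i + k = N - 2 \<and> i \<ge> 1 \<and> k \<ge> (0::nat)}.
                 zeta_mu \<mu> [k + 2] [n] / of_rat (n - m) ^ i))
    \<and> (\<forall>(n::rat) (N::nat). n > 0 \<longrightarrow> N \<ge> 3 \<longrightarrow>
      (\<Sum>(j, k)\<in>{(j, k). j + k = N \<and> j \<ge> 1 \<and> k \<ge> 2}. zeta_mu \<mu> [j, k] [n, 2 * n]) =
        zeta_mu \<mu> [1, N - 1] [n, n] - zeta_mu \<mu> [1, N - 1] [n, 2 * n]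
        - \<mu> * zeta_mu \<mu> [N] [n]
        + D_mu \<mu> [N - 1, 1] [n, n] [n, 2 * n])"
  unfolding sum_admissible_pairs_shift[where f = "\<lambda>i k. zeta_mu \<mu> [k] [_] / _ ^ i"]
    admissible_pairs_def[symmetric]
proof (intro conjI allI impI, goal_cases)
  case (1 m n N)
  thus ?case
    using sum_zeta_mu_admissible_pairs[OF assms, of m n N]
      zeta_mu_diagonal_distinct[OF assms, of m n N] by simp
next
  case (2 n N)
  thus ?case
    using sum_zeta_mu_admissible_pairs[OF assms, of n n N]
      zeta_mu_diagonal_same[OF assms, of n "N - 1"] by (simp flip: mult_2)
qed

end
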